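(* Let $F:\mathbb{N}\to\mathbb{C}$ be an arithmetical function and let $D(s)=\sum_{n\in\mathbb{N}}F(n)n^{-s}$ be the associated Dirichlet series. Suppose that $F$ is bounded on $\mathbb{N}$, that $F(1)\ne 0$, and that the Dirichlet inverse $\widetilde F$ of $F$ is supported on the set of $\kappa$-free numbers for some integer $\kappa\ge 2$ (that is, $\widetilde F(n)=0$ for every $n\in\mathbb{N}$ that is not $\kappa$-free). Then $D(s)\ne 0$ for every $s$ in the half-plane $\{s\in\mathbb{C}:\operatorname{Re}(s)>1\}$.
   Context: $\mathbb{N}$ denotes the set of positive integers. For an arithmetical function $F:\mathbb{N}\to\mathbb{C}$ with $F(1)\ne 0$, the Dirichlet inverse $\widetilde F$ is the arithmetical function determined by $\sum_{ab=n}F(a)\widetilde F(b)=I(n)$ for all $n\in\mathbb{N}$, where $I(1)=1$ and $I(n)=0$ for $n\ge 2$. For an integer $\kappa\ge 2$, a natural number $n$ is $\kappa$-free if $p^\kappa\nmid n$ for every prime $p$. *)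

theory Defs
  imports "HOL-Analysis.Analysis" "HOL-Computational_Algebra.Primes"
begin

text \<open>
  Arithmetical functions are rendered as functions \<^typ>\<open>nat \<Rightarrow> complex\<close> whose value at 0 is
  irrelevant: only arguments in \<open>{1..}\<close>, the positive integers, are ever inspected.
\<close>

text \<open>For \<open>n > 0\<close> the index set is finite and contains only pairs of positive integers.\<close>

definition dirichlet_prod :: "(nat \<Rightarrow> complex) \<Rightarrow> (nat \<Rightarrow> complex) \<Rightarrow> nat \<Rightarrow> complex" where
  "dirichlet_prod F G n = (\<Sum>(a, b) | a * b = n. F a * G b)"

definition dirichlet_unit :: "nat \<Rightarrow> complex" where
  "dirichlet_unit n = (if n = 1 then 1 else 0)"

text \<open>
  The clause \<open>G 0 = 0\<close> only pins down the irrelevant value at 0, so that \<open>G\<close> is unique as a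
  function on \<^typ>\<open>nat\<close>.
\<close>

definition dirichlet_inverse :: "(nat \<Rightarrow> complex) \<Rightarrow> nat \<Rightarrow> complex" where
  "dirichlet_inverse F =
     (THE G. G 0 = 0 \<and> (\<forall>n\<ge>1. dirichlet_prod F G n = dirichlet_unit n))"

definition power_free :: "nat \<Rightarrow> nat \<Rightarrow> bool" where
  "power_free \<kappa> n \<longleftrightarrow> (\<forall>p. prime p \<longrightarrow> \<not> p ^ \<kappa> dvd n)"

definition dirichlet_series :: "(nat \<Rightarrow> complex) \<Rightarrow> complex \<Rightarrow> complex" where
  "dirichlet_series F s = (\<Sum>n. F (Suc n) * of_nat (Suc n) powr (- s))"

lemma finite_factor_pairs:
  assumes "n \<ge> (1 :: nat)"
  shows "finite {(a, b). a * b = n}"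
proof (rule finite_subset)
  show "{(a, b). a * b = n} \<subseteq> {..n} \<times> {..n}"
    using assms by auto
qed simp

lemma dirichlet_prod_split:
  assumes "n \<ge> 1"
  shows "dirichlet_prod F G n = F 1 * G n + (\<Sum>(a, b) | a * b = n \<and> b < n. F a * G b)"
proof -
  have "a = 1 \<and> b = n \<or> b < n" if "a * b = n" for a b
  proof (cases "a = 1")
    case False
    have "b > 0" "a > 0" using that assms by (auto intro!: Nat.gr0I)
    hence "1 * b < a * b" using False by (intro mult_strict_right_mono) auto
    thus ?thesis using that by simp
  qed (use that in simp)
  hence eq: "{(a, b). a * b = n} = insert (1, n) {(a, b). a * b = n \<and> b < n}"
    by auto
  have "finite {(a, b). a * b = n \<and> b < n}"
    by (rule finite_subset[OF _ finite_factor_pairs[OF assms]]) auto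
  thus ?thesis
    unfolding dirichlet_prod_def eq by (subst sum.insert) auto
qed

lemma dirichlet_inverse_ex1:
  assumes "F 1 \<noteq> 0"
  shows "\<exists>!G. G 0 = 0 \<and> (\<forall>n\<ge>1. dirichlet_prod F G n = dirichlet_unit n)"
proof (rule ex_ex1I)
  define P where "P = (\<lambda>(f :: nat \<Rightarrow> complex) n r. (n = 0 \<longrightarrow> r = 0) \<and>
    (n \<ge> 1 \<longrightarrow> F 1 * r + (\<Sum>(a, b) | a * b = n \<and> b < n. F a * f b) = dirichlet_unit n))"
  have "\<exists>f. \<forall>n. P f n (f n)"
  proof (rule dependent_wellorder_choice)
    fix r :: complex and f g :: "nat \<Rightarrow> complex" and n :: nat
    assume "\<And>y. y < n \<Longrightarrow> f y = g y"
    hence "(\<Sum>(a, b) | a * b = n \<and> b < n. F a * f b) = (\<Sum>(a, b) | a * b = n \<and> b < n. F a * g b)"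
      by (intro sum.cong) auto
    thus "P f n r = P g n r"
      by (simp add: P_def)
  next
    fix n :: nat and f :: "nat \<Rightarrow> complex"
    show "\<exists>r. P f n r"
    proof (cases "n = 0")
      case False
      let ?r = "(dirichlet_unit n - (\<Sum>(a, b) | a * b = n \<and> b < n. F a * f b)) / F 1"
      have "P f n ?r"
        using False assms by (simp add: P_def)
      thus ?thesis ..
    qed (simp add: P_def)
  qed
  then obtain f where f: "P f n (f n)" for n
    by blast
  have "f 0 = 0"
    using f[of 0] by (simp add: P_def)
  moreover have "dirichlet_prod F f n = dirichlet_unit n" if "n \<ge> 1" for n
    using f[of n] that by (simp add: P_def dirichlet_prod_split)
  ultimately show "\<exists>G. G 0 = 0 \<and> (\<forall>n\<ge>1. dirichlet_prod F G n = dirichlet_unit n)"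
    by blast
next
  fix G H
  assume G: "G 0 = 0 \<and> (\<forall>n\<ge>1. dirichlet_prod F G n = dirichlet_unit n)"
    and H: "H 0 = 0 \<and> (\<forall>n\<ge>1. dirichlet_prod F H n = dirichlet_unit n)"
  have "G n = H n" for n
  proof (induction n rule: less_induct)
    case (less n)
    show ?case
    proof (cases "n = 0")
      case False
      hence n: "n \<ge> 1" by simp
      have "(\<Sum>(a, b) | a * b = n \<and> b < n. F a * G b) = (\<Sum>(a, b) | a * b = n \<and> b < n. F a * H b)"
        using less by (intro sum.cong) auto
      moreover have "dirichlet_prod F G n = dirichlet_prod F H n"
        using G H n by simp
      ultimately have "F 1 * G n = F 1 * H n"
        unfolding dirichlet_prod_split[OF n] by simp
      thus ?thesis using assms by simp
    qed (use G H in simp)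
  qed
  thus "G = H" ..
qed

lemma dirichlet_prod_inverse:
  assumes "F 1 \<noteq> 0" and "n \<ge> 1"
  shows "dirichlet_prod F (dirichlet_inverse F) n = dirichlet_unit n"
proof -
  have "dirichlet_inverse F 0 = 0 \<and>
      (\<forall>n\<ge>1. dirichlet_prod F (dirichlet_inverse F) n = dirichlet_unit n)"
    unfolding dirichlet_inverse_def by (rule theI'[OF dirichlet_inverse_ex1[where F = F, OF assms(1)]])
  thus ?thesis using assms(2) by simp
qed

end

theory Submission
  imports Defs "HOL-Complex_Analysis.Great_Picard" "HOL-Real_Asymp.Real_Asymp"
begin

text \<open>
  Cut \<open>F\<close> down to the \<open>N\<close>-smooth numbers, those whose prime factors are all at most \<open>N\<close>.
  Since a product is smooth exactly when both factors are, Dirichlet convolution commutes with this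
  restriction (\<open>dirichlet_prod_smooth\<close>), so the restriction of the Dirichlet inverse of \<open>F\<close> is
  still inverse to the restriction of \<open>F\<close>. Only finitely many \<open>N\<close>-smooth numbers are
  \<open>\<kappa>\<close>-free (\<open>finite_smooth_power_free\<close>), so this restricted inverse is the coefficient sequence of
  a Dirichlet polynomial, which is finite at every \<open>s\<close>. In the half-plane \<open>Re s > 1\<close>, where the
  series of the smooth part of \<open>F\<close> converges absolutely, the two may be multiplied, and their
  product is 1; hence the series of the smooth part has no zero there (\<open>smooth_part_nonzero\<close>).
  The truncation is what makes this multiplication legitimate: the inverse of a bounded sequence can
  grow so fast that its full series diverges inside the half-plane.

  As \<open>N\<close> grows, the series of the smooth parts converge to the series of \<open>F\<close>, locally uniformly
  on the half-plane (\<open>uniform_limit_dirichlet_series\<close>). By Hurwitz's theorem the limit is zero-free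
  unless it is constant. A constant limit is harmless too: the series tends to \<open>F 1 \<noteq> 0\<close> along the
  positive real axis (\<open>dirichlet_series_tendsto_at_top\<close>), so it is not the zero function.
\<close>

section \<open>Bounded coefficients\<close>

lemma norm_nat_powr:
  assumes "n \<ge> 1"
  shows "norm ((of_nat n :: complex) powr s) = real n powr Re s"
  using assms by (subst norm_powr_real_powr) auto

lemma summable_Suc_powr:
  assumes "c > 1"
  shows "summable (\<lambda>n. real (Suc n) powr (-c))"
  using assms summable_real_powr_iff[of "-c"]
  by (subst summable_Suc_iff) simp

text \<open>
  The exponent \<open>c\<close> is a reserve kept for summability; what \<open>Re s\<close> exceeds it by becomes a factor
  that is small if \<open>N\<close> is large or if \<open>N \<ge> 1\<close> and \<open>Re s\<close> is large. The first yields locally uniform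
  convergence, the second the limit at infinity.
\<close>

lemma dirichlet_term_bound:
  fixes H :: "nat \<Rightarrow> complex"
  assumes bound: "\<And>n. n \<ge> 1 \<Longrightarrow> norm (H n) \<le> M"
    and vanish: "\<And>n. 1 \<le> n \<Longrightarrow> n \<le> N \<Longrightarrow> H n = 0"
    and s: "Re s \<ge> c" and n: "n \<ge> 1"
  shows "norm (H n * of_nat n powr (-s)) \<le> M * real (Suc N) powr (c - Re s) * real n powr (-c)"
proof (cases "n \<le> N")
  case True
  have "M \<ge> 0" using bound[of 1] norm_ge_zero[of "H 1"] by linarith
  then show ?thesis using vanish[OF n True] by simp
next
  case False
  have "M \<ge> 0" using bound[of 1] norm_ge_zero[of "H 1"] by linarith
  \<comment> \<open>Split \<open>n powr (- Re s)\<close> into \<open>n powr (c - Re s)\<close>, which decreases in \<open>n\<close> and so is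
     largest at \<open>Suc N\<close>, and the summable \<open>n powr (- c)\<close>.\<close>
  have "real n powr (c - Re s) \<le> real (Suc N) powr (c - Re s)"
    using s False by (intro powr_mono2') auto
  then have "norm (H n) * (real n powr (c - Re s) * real n powr (-c))
      \<le> M * (real (Suc N) powr (c - Re s) * real n powr (-c))"
    using \<open>M \<ge> 0\<close> by (intro mult_mono bound n mult_right_mono) auto
  then show ?thesis
    by (simp add: norm_mult norm_nat_powr[OF n] powr_add[symmetric] mult.assoc)
qed

lemma abs_summable_dirichlet_series:
  fixes F :: "nat \<Rightarrow> complex"
  assumes "\<And>n. n \<ge> 1 \<Longrightarrow> norm (F n) \<le> M" and "Re s > 1"
  shows "summable (\<lambda>n. norm (F (Suc n) * of_nat (Suc n) powr (-s)))"
proof (rule summable_comparison_test)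
  show "summable (\<lambda>n. M * real (Suc n) powr (- Re s))"
    by (intro summable_mult summable_Suc_powr assms)
  have "norm (norm (F (Suc n) * of_nat (Suc n) powr (-s))) \<le> M * real (Suc n) powr (- Re s)" for n
    using dirichlet_term_bound[of F M 0 "Re s" s "Suc n"] assms by simp
  then show "\<exists>N. \<forall>n\<ge>N. norm (norm (F (Suc n) * of_nat (Suc n) powr (-s))) \<le> M * real (Suc n) powr (- Re s)"
    by blast
qed

lemma dirichlet_series_bound:
  fixes H :: "nat \<Rightarrow> complex"
  assumes bound: "\<And>n. n \<ge> 1 \<Longrightarrow> norm (H n) \<le> M"
    and vanish: "\<And>n. 1 \<le> n \<Longrightarrow> n \<le> N \<Longrightarrow> H n = 0"
    and c: "c > 1" and s: "Re s \<ge> c"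
  shows "norm (dirichlet_series H s)
           \<le> M * real (Suc N) powr (c - Re s) * (\<Sum>n. real (Suc n) powr (-c))"
proof -
  have "norm (dirichlet_series H s)
      \<le> (\<Sum>n. M * real (Suc N) powr (c - Re s) * real (Suc n) powr (-c))"
    unfolding dirichlet_series_def
  proof (rule norm_suminf_le)
    fix n
    show "norm (H (Suc n) * of_nat (Suc n) powr (-s))
        \<le> M * real (Suc N) powr (c - Re s) * real (Suc n) powr (-c)"
      by (rule dirichlet_term_bound[where H = H and n = "Suc n"]) (use bound vanish s in auto)
    show "summable (\<lambda>n. M * real (Suc N) powr (c - Re s) * real (Suc n) powr (-c))"
      by (intro summable_mult summable_Suc_powr c)
  qed
  also have "\<dots> = M * real (Suc N) powr (c - Re s) * (\<Sum>n. real (Suc n) powr (-c))"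
    by (intro suminf_mult summable_Suc_powr c)
  finally show ?thesis .
qed

lemma dirichlet_series_diff_bound:
  fixes F F' :: "nat \<Rightarrow> complex"
  assumes F: "\<And>n. n \<ge> 1 \<Longrightarrow> norm (F n) \<le> M"
    and F': "\<And>n. n \<ge> 1 \<Longrightarrow> norm (F' n) \<le> M"
    and agree: "\<And>n. 1 \<le> n \<Longrightarrow> n \<le> N \<Longrightarrow> F n = F' n"
    and c: "c > 1" and s: "Re s \<ge> c"
  shows "norm (dirichlet_series F s - dirichlet_series F' s)
           \<le> 2 * M * real (Suc N) powr (c - Re s) * (\<Sum>n. real (Suc n) powr (-c))"
proof -
  have "Re s > 1" using c s by simp
  note summable = summable_norm_cancel[OF abs_summable_dirichlet_series[OF F \<open>Re s > 1\<close>]]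
    summable_norm_cancel[OF abs_summable_dirichlet_series[OF F' \<open>Re s > 1\<close>]]
  have "dirichlet_series F s - dirichlet_series F' s = dirichlet_series (\<lambda>n. F n - F' n) s"
    unfolding dirichlet_series_def
    by (subst suminf_diff) (use summable in \<open>auto simp: algebra_simps\<close>)
  also have "norm \<dots> \<le> 2 * M * real (Suc N) powr (c - Re s) * (\<Sum>n. real (Suc n) powr (-c))"
  proof (rule dirichlet_series_bound)
    show "norm (F n - F' n) \<le> 2 * M" if "n \<ge> 1" for n
      using norm_triangle_ineq4[of "F n" "F' n"] F[OF that] F'[OF that] by linarith
  qed (use agree c s in auto)
  finally show ?thesis .
qed

text \<open>
  The sequence \<open>T\<close> is an arbitrary truncation of \<open>F\<close>: cutting off at \<open>N\<close> gives holomorphy of the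
  series, and restricting to smooth numbers gives the approximants for Hurwitz's theorem.
\<close>

lemma uniform_limit_dirichlet_series:
  fixes F :: "nat \<Rightarrow> complex" and T :: "nat \<Rightarrow> nat \<Rightarrow> complex"
  assumes F: "\<And>n. n \<ge> 1 \<Longrightarrow> norm (F n) \<le> M"
    and T: "\<And>N n. n \<ge> 1 \<Longrightarrow> norm (T N n) \<le> M"
    and agree: "\<And>N n. 1 \<le> n \<Longrightarrow> n \<le> N \<Longrightarrow> T N n = F n"
    and K: "compact K" "K \<subseteq> {s. Re s > 1}"
  shows "uniform_limit K (\<lambda>N. dirichlet_series (T N)) (dirichlet_series F) sequentially"
proof (cases "K = {}")
  case False
  obtain s0 where s0: "s0 \<in> K" "\<And>s. s \<in> K \<Longrightarrow> Re s0 \<le> Re s"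
    using continuous_attains_inf[OF K(1) False, of Re] continuous_on_Re[OF continuous_on_id] by auto
  \<comment> \<open>Any exponent strictly between 1 and the least real part on \<open>K\<close> serves: above 1 for
     summability, below \<open>Re s0\<close> for decay in \<open>N\<close>.\<close>
  define c where "c = (1 + Re s0) / 2"
  have c: "c > 1" "c < Re s0" using s0(1) K(2) by (auto simp: c_def)
  define Z where "Z = (\<Sum>n. real (Suc n) powr (-c))"
  have "Z \<ge> 0" unfolding Z_def by (intro suminf_nonneg summable_Suc_powr c) auto
  have "M \<ge> 0" using F[of 1] norm_ge_zero[of "F 1"] by linarith
  define B where "B = (\<lambda>N. 2 * M * real (Suc N) powr (c - Re s0) * Z)"
  have le: "dist (dirichlet_series (T N) s) (dirichlet_series F s) \<le> B N" if "s \<in> K" for N s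
  proof -
    have "dist (dirichlet_series (T N) s) (dirichlet_series F s)
        \<le> 2 * M * real (Suc N) powr (c - Re s) * Z"
      unfolding dist_norm Z_def
      by (rule dirichlet_series_diff_bound) (use F T agree c s0(2)[OF that] in auto)
    also have "\<dots> \<le> B N"
      unfolding B_def using \<open>M \<ge> 0\<close> \<open>Z \<ge> 0\<close> s0(2)[OF that]
      by (intro mult_right_mono mult_left_mono powr_mono) auto
    finally show ?thesis .
  qed
  have "(\<lambda>N. real (Suc N) powr (c - Re s0)) \<longlonglongrightarrow> 0"
    using c
    by (intro tendsto_neg_powr filterlim_compose[OF filterlim_real_sequentially filterlim_Suc]) auto
  then have "B \<longlonglongrightarrow> 2 * M * 0 * Z"
    unfolding B_def by (intro tendsto_intros)
  then have "B \<longlonglongrightarrow> 0" by simp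
  show ?thesis
  proof (rule uniform_limitI)
    fix e :: real assume "e > 0"
    have "eventually (\<lambda>N. B N < e) sequentially"
      using order_tendstoD(2)[OF \<open>B \<longlonglongrightarrow> 0\<close> \<open>e > 0\<close>] .
    then show "\<forall>\<^sub>F N in sequentially. \<forall>s\<in>K. dist (dirichlet_series (T N) s) (dirichlet_series F s) < e"
      by eventually_elim (meson le le_less_trans)
  qed
qed simp

lemma holomorphic_dirichlet_series:
  fixes F :: "nat \<Rightarrow> complex"
  assumes F: "\<And>n. n \<ge> 1 \<Longrightarrow> norm (F n) \<le> M"
  shows "dirichlet_series F holomorphic_on {s. Re s > 1}"
proof -
  define T where "T = (\<lambda>N n. if n \<le> N then F n else 0)"
  have "M \<ge> 0" using F[of 1] norm_ge_zero[of "F 1"] by linarith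
  have T_eq: "dirichlet_series (T N) s = (\<Sum>n<N. F (Suc n) * of_nat (Suc n) powr (-s))" for N s
    unfolding dirichlet_series_def T_def
    by (subst suminf_finite[of "{..<N}"]) (auto intro!: sum.cong)
  show ?thesis
  proof (rule holomorphic_uniform_sequence[OF open_halfspace_Re_gt])
    show "dirichlet_series (T N) holomorphic_on {s. Re s > 1}" for N
      unfolding T_eq[abs_def] by (auto intro!: holomorphic_intros simp del: of_nat_Suc)
    fix s :: complex assume "s \<in> {s. Re s > 1}"
    then obtain d where d: "d > 0" "cball s d \<subseteq> {s. Re s > 1}"
      using open_halfspace_Re_gt open_contains_cball by blast
    moreover have "uniform_limit (cball s d) (\<lambda>N. dirichlet_series (T N)) (dirichlet_series F) sequentially"
      by (rule uniform_limit_dirichlet_series[where M = M])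
        (use F d \<open>M \<ge> 0\<close> in \<open>auto simp: T_def\<close>)
    ultimately show "\<exists>d>0. cball s d \<subseteq> {s. Re s > 1} \<and>
        uniform_limit (cball s d) (\<lambda>N. dirichlet_series (T N)) (dirichlet_series F) sequentially"
      by blast
  qed
qed

lemma dirichlet_series_monomial: "dirichlet_series (\<lambda>n. if n = 1 then a else 0) s = a"
  unfolding dirichlet_series_def
  by (subst suminf_finite[of "{0}"]) auto

text \<open>
  Compare \<open>F\<close> with the sequence that keeps only \<open>F 1\<close>: the difference starts at \<open>n = 2\<close>, so it is
  \<open>O(2 powr (- x))\<close>.
\<close>

lemma dirichlet_series_tendsto_at_top:
  fixes F :: "nat \<Rightarrow> complex"
  assumes F: "\<And>n. n \<ge> 1 \<Longrightarrow> norm (F n) \<le> M"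
  shows "((\<lambda>x. dirichlet_series F (of_real x)) \<longlongrightarrow> F 1) at_top"
proof -
  define Z where "Z = (\<Sum>n. real (Suc n) powr (-2))"
  have "M \<ge> 0" using F[of 1] norm_ge_zero[of "F 1"] by linarith
  have "((\<lambda>x::real. 2 * M * 2 powr (2 - x) * Z) \<longlongrightarrow> 2 * M * 0 * Z) at_top"
    by (intro tendsto_mult tendsto_const) real_asymp
  then have lim: "((\<lambda>x::real. 2 * M * 2 powr (2 - x) * Z) \<longlongrightarrow> 0) at_top" by simp
  have bound: "norm (dirichlet_series F (of_real x) - F 1) \<le> 2 * M * 2 powr (2 - x) * Z"
    if "x \<ge> 2" for x
  proof -
    have "norm (dirichlet_series F (of_real x) - dirichlet_series (\<lambda>n. if n = 1 then F 1 else 0) (of_real x))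
        \<le> 2 * M * real (Suc 1) powr (2 - Re (of_real x)) * Z"
      unfolding Z_def
    proof (rule dirichlet_series_diff_bound)
      show "norm (F n) \<le> M" if "n \<ge> 1" for n using F[OF that] .
      show "norm (if n = 1 then F 1 else 0) \<le> M" for n :: nat
        using F[of 1] \<open>M \<ge> 0\<close> by simp
      show "F n = (if n = 1 then F 1 else 0)" if "1 \<le> n" "n \<le> 1" for n
        using le_antisym[OF that] by simp
    qed (use that in auto)
    then show ?thesis by (simp only: dirichlet_series_monomial Re_complex_of_real) simp
  qed
  have "\<forall>\<^sub>F x in at_top. norm (dirichlet_series F (of_real x) - F 1) \<le> 2 * M * 2 powr (2 - x) * Z"
    by (rule eventually_mono[OF eventually_ge_at_top[of "2::real"] bound])
  from Lim_null_comparison[OF this lim] show ?thesis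
    by (simp add: LIM_zero_iff)
qed

section \<open>Smooth numbers\<close>

definition smooth_numbers :: "nat \<Rightarrow> nat set" where
  "smooth_numbers N = {n. n \<ge> 1 \<and> (\<forall>p. prime p \<longrightarrow> p dvd n \<longrightarrow> p \<le> N)}"

lemma le_imp_smooth: "1 \<le> n \<Longrightarrow> n \<le> N \<Longrightarrow> n \<in> smooth_numbers N"
  by (auto simp: smooth_numbers_def dest: dvd_imp_le)

lemma one_smooth: "1 \<in> smooth_numbers N"
  by (auto simp: smooth_numbers_def)

lemma mult_smooth_iff:
  "a * b \<in> smooth_numbers N \<longleftrightarrow> a \<in> smooth_numbers N \<and> b \<in> smooth_numbers N"
  by (auto simp: smooth_numbers_def prime_dvd_mult_iff)

text \<open>
  In an \<open>N\<close>-smooth \<open>k\<close>-free number every prime is at most \<open>N\<close>, hence divides \<open>N!\<close>, and occurs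
  with exponent below \<open>k\<close>; so the number divides \<open>(N!) ^ k\<close>.
\<close>

lemma finite_smooth_power_free: "finite {n \<in> smooth_numbers N. power_free k n}"
proof (rule finite_subset)
  show "finite {d. d dvd (fact N :: nat) ^ k}" by (intro finite_divisors_nat) simp
  show "{n \<in> smooth_numbers N. power_free k n} \<subseteq> {d. d dvd (fact N :: nat) ^ k}"
  proof safe
    fix n assume n: "n \<in> smooth_numbers N" "power_free k n"
    show "n dvd fact N ^ k"
    proof (rule multiplicity_le_imp_dvd)
      show "n \<noteq> 0" using n by (auto simp: smooth_numbers_def)
      fix p :: nat assume p: "prime p"
      show "multiplicity p n \<le> multiplicity p (fact N ^ k)"
      proof (cases "p dvd n")
        case True
        have "p \<le> N" using True n p by (auto simp: smooth_numbers_def)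
        then have "p ^ k dvd fact N ^ k"
          using p by (intro dvd_power_same) (simp add: prime_dvd_fact_iff)
        moreover have "\<not> p ^ k dvd n" using n p by (auto simp: power_free_def)
        ultimately have "multiplicity p n < k" "k \<le> multiplicity p (fact N ^ k)"
          using p \<open>n \<noteq> 0\<close> by (auto intro!: multiplicity_geI multiplicity_lessI)
        then show ?thesis by simp
      qed (simp add: not_dvd_imp_multiplicity_0)
    qed
  qed
qed

lemma dirichlet_prod_smooth:
  fixes F G :: "nat \<Rightarrow> complex" and N :: nat
  defines "S \<equiv> smooth_numbers N"
  shows "dirichlet_prod (\<lambda>n. if n \<in> S then F n else 0) (\<lambda>n. if n \<in> S then G n else 0) n
    = (if n \<in> S then dirichlet_prod F G n else 0)"
proof (cases "n \<in> S")
  case True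
  then have "a \<in> S \<and> b \<in> S" if "a * b = n" for a b
    using that mult_smooth_iff S_def by blast
  then have "(\<Sum>(a, b) | a * b = n. (if a \<in> S then F a else 0) * (if b \<in> S then G b else 0))
      = (\<Sum>(a, b) | a * b = n. F a * G b)"
    by (intro sum.cong refl) (clarsimp simp only: if_True mem_Collect_eq prod.case)
  then show ?thesis unfolding dirichlet_prod_def using True by simp
next
  case False
  then have nS: "a \<notin> S \<or> b \<notin> S" if "a * b = n" for a b
    using that mult_smooth_iff S_def by blast
  have "(\<Sum>(a, b) | a * b = n. (if a \<in> S then F a else 0) * (if b \<in> S then G b else 0)) = 0"
    by (rule sum.neutral) (use nS in force)
  then show ?thesis unfolding dirichlet_prod_def using False by simp
qed

section \<open>Multiplication by a Dirichlet polynomial\<close>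

lemma has_sum_dirichlet_series:
  fixes F :: "nat \<Rightarrow> complex"
  assumes "\<And>n. n \<ge> 1 \<Longrightarrow> norm (F n) \<le> M" and "Re s > 1"
  shows "((\<lambda>n. F n * of_nat n powr (-s)) has_sum dirichlet_series F s) {1..}"
proof -
  note summable = abs_summable_dirichlet_series[of F M s, OF assms]
  have "((\<lambda>n. F (Suc n) * of_nat (Suc n) powr (-s)) has_sum dirichlet_series F s) UNIV"
    unfolding dirichlet_series_def
    by (rule norm_summable_imp_has_sum[OF summable summable_sums[OF summable_norm_cancel[OF summable]]])
  moreover have "range Suc = {1..}" by (auto simp: image_def Suc_le_eq gr0_conv_Suc)
  ultimately show ?thesis
    using has_sum_reindex[of Suc UNIV "\<lambda>n. F n * of_nat n powr (-s)"] by (simp add: o_def)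
qed

lemma dirichlet_series_eqI:
  fixes F :: "nat \<Rightarrow> complex"
  assumes "((\<lambda>n. F n * of_nat n powr (-s)) has_sum D) {1..}"
  shows "dirichlet_series F s = D"
proof -
  have "range Suc = {1..}" by (auto simp: image_def Suc_le_eq gr0_conv_Suc)
  then have "((\<lambda>n. F (Suc n) * of_nat (Suc n) powr (-s)) has_sum D) UNIV"
    using has_sum_reindex[of Suc UNIV "\<lambda>n. F n * of_nat n powr (-s)"] assms by (simp add: o_def)
  from has_sum_imp_sums[OF this] show ?thesis
    unfolding dirichlet_series_def by (simp add: sums_iff)
qed

lemma dirichlet_prod_finite_support:
  fixes F G :: "nat \<Rightarrow> complex"
  assumes A: "finite A" "A \<subseteq> {1..}"
    and supp: "\<And>n. n \<ge> 1 \<Longrightarrow> n \<notin> A \<Longrightarrow> G n = 0" and n: "n \<ge> 1"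
  shows "dirichlet_prod F G n = (\<Sum>b\<in>A. if b dvd n then F (n div b) * G b else 0)"
proof -
  have "dirichlet_prod F G n = (\<Sum>(a, b) | a * b = n \<and> b \<in> A. F a * G b)"
    unfolding dirichlet_prod_def
  proof (rule sum.mono_neutral_right)
    have "F a * G b = 0" if "a * b = n" "b \<notin> A" for a b
    proof -
      have "b \<ge> 1" using n that by (cases "b = 0") auto
      then show ?thesis using that by (simp add: supp)
    qed
    then show "\<forall>p\<in>{(a, b). a * b = n} - {(a, b). a * b = n \<and> b \<in> A}. (case p of (a, b) \<Rightarrow> F a * G b) = 0"
      by fastforce
  qed (use finite_factor_pairs[OF n] in auto)
  also have "\<dots> = (\<Sum>b\<in>{b\<in>A. b dvd n}. F (n div b) * G b)"
    by (rule sum.reindex_bij_witness[of _ "\<lambda>b. (n div b, b)" snd]) (use A in auto)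
  also have "\<dots> = (\<Sum>b\<in>A. if b dvd n then F (n div b) * G b else 0)"
    using A by (simp add: sum.inter_filter)
  finally show ?thesis .
qed

text \<open>
  Each term of the polynomial moves the series of \<open>F\<close> from all positive integers to the multiples
  of its index \<open>b\<close>; a finite sum of these rearrangements collects the coefficient of the
  convolution at every \<open>n\<close>.
\<close>

lemma dirichlet_series_mult_polynomial:
  fixes F G :: "nat \<Rightarrow> complex"
  assumes F: "\<And>n. n \<ge> 1 \<Longrightarrow> norm (F n) \<le> M" and s: "Re s > 1"
    and A: "finite A" "A \<subseteq> {1..}"
    and supp: "\<And>n. n \<ge> 1 \<Longrightarrow> n \<notin> A \<Longrightarrow> G n = 0"
  shows "dirichlet_series (dirichlet_prod F G) s
    = dirichlet_series F s * (\<Sum>b\<in>A. G b * of_nat b powr (-s))"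
proof (rule dirichlet_series_eqI)
  define t where "t = (\<lambda>b n. (if b dvd n then F (n div b) * G b else 0) * (of_nat n :: complex) powr (-s))"
  have "(t b has_sum dirichlet_series F s * (G b * of_nat b powr (-s))) {1..}" if b: "b \<in> A" for b
  proof -
    have "b \<ge> 1" using A b by auto
    have "((\<lambda>a. F a * of_nat a powr (-s) * (G b * of_nat b powr (-s))) has_sum
        dirichlet_series F s * (G b * of_nat b powr (-s))) {1..}"
      by (intro has_sum_cmult_left has_sum_dirichlet_series[OF F s])
    also have "(\<lambda>a. F a * of_nat a powr (-s) * (G b * of_nat b powr (-s))) = t b \<circ> (\<lambda>a. a * b)"
      using \<open>b \<ge> 1\<close> by (auto simp: t_def fun_eq_iff powr_times_real)
    finally have "(t b has_sum dirichlet_series F s * (G b * of_nat b powr (-s))) ((\<lambda>a. a * b) ` {1..})"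
      using \<open>b \<ge> 1\<close> by (subst has_sum_reindex) (auto simp: inj_on_def o_def)
    moreover have "t b n = 0" if "n \<in> {1..} - (\<lambda>a. a * b) ` {1..}" for n
    proof -
      have "\<not> b dvd n" using that \<open>b \<ge> 1\<close> by (auto elim!: dvdE simp: image_iff mult.commute)
      then show ?thesis by (simp add: t_def)
    qed
    moreover have "(\<lambda>a. a * b) ` {1..} \<subseteq> {1..}" using \<open>b \<ge> 1\<close> by auto
    ultimately show ?thesis
      using has_sum_cong_neutral[of "{1..}" "(\<lambda>a. a * b) ` {1..}" "t b" "t b"] by blast
  qed
  with A(1) have "((\<lambda>n. \<Sum>b\<in>A. t b n) has_sum (\<Sum>b\<in>A. dirichlet_series F s * (G b * of_nat b powr (-s)))) {1..}"
    by (induction A rule: finite_induct) (auto intro: has_sum_add)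
  moreover have "(\<Sum>b\<in>A. t b n) = dirichlet_prod F G n * of_nat n powr (-s)" if "n \<in> {1..}" for n
    using dirichlet_prod_finite_support[of A G n F] A supp that by (simp add: t_def sum_distrib_right)
  ultimately show "((\<lambda>n. dirichlet_prod F G n * of_nat n powr (-s)) has_sum
      dirichlet_series F s * (\<Sum>b\<in>A. G b * of_nat b powr (-s))) {1..}"
    unfolding sum_distrib_left by (subst has_sum_cong[where g = "\<lambda>n. \<Sum>b\<in>A. t b n"]) auto
qed

section \<open>Nonvanishing\<close>

lemma smooth_part_nonzero:
  fixes F :: "nat \<Rightarrow> complex"
  assumes F: "\<And>n. n \<ge> 1 \<Longrightarrow> norm (F n) \<le> M" and F1: "F 1 \<noteq> 0"
    and supp: "\<And>n. n \<ge> 1 \<Longrightarrow> \<not> power_free k n \<Longrightarrow> dirichlet_inverse F n = 0"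
    and s: "Re s > 1"
  shows "dirichlet_series (\<lambda>n. if n \<in> smooth_numbers N then F n else 0) s \<noteq> 0"
proof -
  define S where "S = smooth_numbers N"
  define A where "A = {n \<in> S. power_free k n}"
  define FS where "FS = (\<lambda>n. if n \<in> S then F n else 0)"
  define GS where "GS = (\<lambda>n. if n \<in> S then dirichlet_inverse F n else 0)"
  have "M \<ge> 0" using F[of 1] norm_ge_zero[of "F 1"] by linarith
  have unit: "dirichlet_prod FS GS n = dirichlet_unit n" if "n \<ge> 1" for n
    using that dirichlet_prod_smooth[of N F "dirichlet_inverse F" n] one_smooth[of N]
      dirichlet_prod_inverse[of F n, OF F1 that]
    by (auto simp: FS_def GS_def S_def dirichlet_unit_def)
  have "dirichlet_series FS s * (\<Sum>b\<in>A. GS b * of_nat b powr (-s))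
      = dirichlet_series (dirichlet_prod FS GS) s"
  proof (rule dirichlet_series_mult_polynomial[symmetric])
    show "finite A" unfolding A_def S_def by (rule finite_smooth_power_free)
    show "A \<subseteq> {1..}" by (auto simp: A_def S_def smooth_numbers_def)
    show "norm (FS n) \<le> M" if "n \<ge> 1" for n using F[OF that] \<open>M \<ge> 0\<close> by (simp add: FS_def)
    show "GS n = 0" if "n \<ge> 1" "n \<notin> A" for n using that supp[of n] by (auto simp: GS_def A_def)
  qed (rule s)
  also have "\<dots> = dirichlet_series (\<lambda>n. if n = 1 then 1 else 0) s"
    unfolding dirichlet_series_def by (simp add: unit dirichlet_unit_def)
  also have "\<dots> = 1" by (rule dirichlet_series_monomial)
  finally show ?thesis unfolding FS_def S_def by auto
qed

theorem theorem2p1: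
  fixes F :: "nat \<Rightarrow> complex" and \<kappa> :: nat and s :: complex
  assumes "bounded (F ` {1..})"
    and "F 1 \<noteq> 0"
    and "\<kappa> \<ge> 2"
    and "\<And>n. n \<ge> 1 \<Longrightarrow> \<not> power_free \<kappa> n \<Longrightarrow> dirichlet_inverse F n = 0"
    and "Re s > 1"
  shows "dirichlet_series F s \<noteq> 0"
proof
  assume zero: "dirichlet_series F s = 0"
  obtain M where M: "norm (F n) \<le> M" if "n \<ge> 1" for n
    using assms(1) by (auto simp: bounded_iff)
  have "M \<ge> 0" using M[of 1] norm_ge_zero[of "F 1"] by linarith
  define T where "T = (\<lambda>N n. if n \<in> smooth_numbers N then F n else 0)"
  have T: "norm (T N n) \<le> M" if "n \<ge> 1" for N n
    using M[OF that] \<open>M \<ge> 0\<close> by (simp add: T_def)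
  have nonconstant: "\<not> dirichlet_series F constant_on {s. Re s > 1}"
  proof
    assume "dirichlet_series F constant_on {s. Re s > 1}"
    then have "dirichlet_series F z = 0" if "Re z > 1" for z
      using zero assms(5) that by (auto simp: constant_on_def)
    then have "\<forall>\<^sub>F x in at_top. dirichlet_series F (of_real x) = 0"
      by (intro eventually_mono[OF eventually_gt_at_top[of "1::real"]]) auto
    then have "((\<lambda>x. dirichlet_series F (of_real x)) \<longlongrightarrow> 0) at_top"
      by (rule tendsto_eventually)
    from tendsto_unique[OF _ dirichlet_series_tendsto_at_top[OF M] this] show False
      using assms(2) by simp
  qed
  have "dirichlet_series F s \<noteq> 0"
  proof (rule Hurwitz_no_zeros[of "{s. Re s > 1}" "\<lambda>N. dirichlet_series (T N)" "dirichlet_series F" s])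
    show "open {s :: complex. Re s > 1}" by (rule open_halfspace_Re_gt)
    show "\<not> dirichlet_series F constant_on {s. Re s > 1}" by (rule nonconstant)
    show "connected {s :: complex. Re s > 1}"
      by (intro convex_connected convex_halfspace_Re_gt)
    show "uniform_limit K (\<lambda>N. dirichlet_series (T N)) (dirichlet_series F) sequentially"
      if "compact K" "K \<subseteq> {s. Re s > 1}" for K
      using M T that by (intro uniform_limit_dirichlet_series[of F M T]) (auto simp: T_def le_imp_smooth)
    show "dirichlet_series (T N) z \<noteq> 0" if "z \<in> {s. Re s > 1}" for N z
      unfolding T_def using that by (intro smooth_part_nonzero[OF M assms(2,4)]) auto
    show "dirichlet_series (T N) holomorphic_on {s. Re s > 1}" for N
      by (rule holomorphic_dirichlet_series[OF T])
    show "dirichlet_series F holomorphic_on {s. Re s > 1}"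
      by (rule holomorphic_dirichlet_series[OF M])
    show "s \<in> {s. Re s > 1}" using assms(5) by simp
  qed
  with zero show False by simp
qed

end
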